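(* Let $(X,\hookrightarrow,\mathcal{P})$ be a primal-proximity space and $A,B\subseteq X$. Then the following properties hold: (1) if $A\subseteq B$, then $\overset{\hookrightarrow}{A}\subseteq\overset{\hookrightarrow}{B}$; (2) $\overset{\hookrightarrow}{(A\cap B)}\subseteq\overset{\hookrightarrow}{A}\cap\overset{\hookrightarrow}{B}$; (3) $\overset{\hookrightarrow}{A}\cup\overset{\hookrightarrow}{B}=\overset{\hookrightarrow}{(A\cup B)}$; (4) $\overset{\hookrightarrow}{\overset{\hookrightarrow}{A}}\subseteq\overset{\hookrightarrow}{A}$; (5) if $A^c\notin\mathcal{P}$, then $\overset{\hookrightarrow}{A}=\emptyset$; (6) $\overset{\hookrightarrow}{\emptyset}=\emptyset$; (7) $\overset{\hookrightarrow}{A}\setminus\overset{\hookrightarrow}{B}\subseteq\overset{\hookrightarrow}{(A\setminus B)}$; (8) if $B^c\notin\mathcal{P}$, then $\overset{\hookrightarrow}{(A\cup B)}=\overset{\hookrightarrow}{A}=\overset{\hookrightarrow}{(A\setminus B)}$; (9) if $[(A\setminus B)\cup(B\setminus A)]^c\notin\mathcal{P}$, then $\overset{\hookrightarrow}{A}=\overset{\hookrightarrow}{B}$.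
   Context: $A^c$ denotes $X\setminus A$. A primal on a non-empty set $X$ is a collection $\mathcal{P}\subseteq 2^X$ such that (i) $X\notin\mathcal{P}$; (ii) if $A\in\mathcal{P}$ and $B\subseteq A$, then $B\in\mathcal{P}$; (iii) if $A\cap B\in\mathcal{P}$, then $A\in\mathcal{P}$ or $B\in\mathcal{P}$. A primal-proximity space $(X,\hookrightarrow,\mathcal{P})$ is a non-empty set $X$ with a primal $\mathcal{P}$ on $X$ and a binary relation $\hookrightarrow$ on $2^X$ such that for all $A,B,C\subseteq X$: (1) if $A\hookrightarrow B$, then $B\hookrightarrow A$; (2) $A\hookrightarrow (B\cup C)$ iff $A\hookrightarrow B$ or $A\hookrightarrow C$; (3) if $A^c\notin\mathcal{P}$, then $A\not\hookrightarrow B$ for all $B\subseteq X$; (4) if $(A\cap B)^c\in\mathcal{P}$, then $A\hookrightarrow B$; (5) if $A\not\hookrightarrow B$, then there exist $C,D\subseteq X$ such that $A\not\hookrightarrow C^c$, $D^c\not\hookrightarrow B$ and $(C\cap D)^c\notin\mathcal{P}$. For $A\subseteq X$, $\overset{\hookrightarrow}{A}:=\{x\in X : \{x\}\hookrightarrow A\}$ (the point-primal proximity of $A$); $\overset{\hookrightarrow}{\overset{\hookrightarrow}{A}}$ is this operator applied twice. *)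

theory Defs
  imports Main
begin

locale primal =
  fixes X :: "'a set" and P :: "'a set set"
  assumes nonempty: "X \<noteq> {}"
    and subsets: "P \<subseteq> Pow X"
    and carrier_notin: "X \<notin> P"
    and down_closed: "\<lbrakk>A \<in> P; B \<subseteq> A\<rbrakk> \<Longrightarrow> B \<in> P"
    and inter: "\<lbrakk>A \<subseteq> X; B \<subseteq> X; A \<inter> B \<in> P\<rbrakk> \<Longrightarrow> A \<in> P \<or> B \<in> P"

(* The proximity is a relation on the power set of X; its values on sets that
   are not contained in X are unconstrained and never used. *)
locale primal_proximity_space = primal X P
  for X :: "'a set"
    and prox :: "'a set \<Rightarrow> 'a set \<Rightarrow> bool" (infix \<open>\<hookrightarrow>\<close> 50)
    and P :: "'a set set" +
  assumes sym: "\<lbrakk>A \<subseteq> X; B \<subseteq> X; A \<hookrightarrow> B\<rbrakk> \<Longrightarrow> B \<hookrightarrow> A"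
    and union: "\<lbrakk>A \<subseteq> X; B \<subseteq> X; C \<subseteq> X\<rbrakk> \<Longrightarrow> A \<hookrightarrow> (B \<union> C) \<longleftrightarrow> A \<hookrightarrow> B \<or> A \<hookrightarrow> C"
    and compl_notin: "\<lbrakk>A \<subseteq> X; X - A \<notin> P; B \<subseteq> X\<rbrakk> \<Longrightarrow> \<not> A \<hookrightarrow> B"
    and compl_inter_in: "\<lbrakk>A \<subseteq> X; B \<subseteq> X; X - (A \<inter> B) \<in> P\<rbrakk> \<Longrightarrow> A \<hookrightarrow> B"
    and separation: "\<lbrakk>A \<subseteq> X; B \<subseteq> X; \<not> A \<hookrightarrow> B\<rbrakk> \<Longrightarrow>
      \<exists>C D. C \<subseteq> X \<and> D \<subseteq> X \<and> \<not> A \<hookrightarrow> (X - C) \<and> \<not> (X - D) \<hookrightarrow> B \<and> X - (C \<inter> D) \<notin> P"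

definition point_primal_proximity ::
    "'a set \<Rightarrow> ('a set \<Rightarrow> 'a set \<Rightarrow> bool) \<Rightarrow> 'a set \<Rightarrow> 'a set" where
  "point_primal_proximity X prox A = {x \<in> X. prox {x} A}"

end

theory Submission
  imports Defs
begin

context primal_proximity_space
begin

abbreviation cl :: "'a set \<Rightarrow> 'a set" where
  "cl \<equiv> point_primal_proximity X prox"

lemma mem_cl_iff: "x \<in> cl A \<longleftrightarrow> x \<in> X \<and> {x} \<hookrightarrow> A"
  by (simp add: point_primal_proximity_def)

text \<open>Since \<open>B \<union> C = C\<close>, the right-to-left direction of the axiom
  \<open>union\<close> turns nearness to \<open>B\<close> into nearness to \<open>C\<close>.\<close>

lemma prox_mono_right:
  assumes "A \<subseteq> X" "C \<subseteq> X" "B \<subseteq> C" "A \<hookrightarrow> B"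
  shows "A \<hookrightarrow> C"
proof -
  have "B \<union> C = C" using assms(3) by blast
  then show ?thesis using union[of A B C] assms by auto
qed

lemma prox_mono_left:
  assumes "B \<subseteq> X" "C \<subseteq> X" "A \<subseteq> C" "A \<hookrightarrow> B"
  shows "C \<hookrightarrow> B"
proof -
  have A: "A \<subseteq> X" using assms by blast
  have "B \<hookrightarrow> C"
    using prox_mono_right[OF assms(1,2,3)] sym[OF A assms(1,4)] by blast
  then show ?thesis by (rule sym[OF assms(1,2)])
qed

lemma cl_mono: "A \<subseteq> B \<Longrightarrow> B \<subseteq> X \<Longrightarrow> cl A \<subseteq> cl B"
  using prox_mono_right[of "{_}" B A] by (auto simp: mem_cl_iff)

lemma cl_Un: "A \<subseteq> X \<Longrightarrow> B \<subseteq> X \<Longrightarrow> cl (A \<union> B) = cl A \<union> cl B"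
  using union[of "{_}" A B] by (auto simp: mem_cl_iff)

text \<open>The axiom \<open>compl_notin\<close> isolates a negligible set only as the left argument
  of the relation, whereas \<open>cl\<close> has it on the right; \<open>sym\<close> bridges the
  two.\<close>

lemma cl_eq_empty:
  assumes "A \<subseteq> X" "X - A \<notin> P"
  shows "cl A = {}"
proof -
  have "\<not> {x} \<hookrightarrow> A" if "x \<in> X" for x
    using compl_notin[of A "{x}"] sym[of "{x}" A] assms that by auto
  then show ?thesis by (auto simp: mem_cl_iff)
qed

lemma cl_empty: "cl {} = {}"
  using cl_eq_empty[of "{}"] carrier_notin by simp

text \<open>Monotonicity and additivity of \<open>cl\<close> applied to
  \<open>A \<subseteq> B \<union> (A - B)\<close>. This splitting drives idempotence, the difference
  law and the invariance under negligible changes.\<close>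

lemma cl_subset_Un_Diff:
  assumes "A \<subseteq> X" "B \<subseteq> X"
  shows "cl A \<subseteq> cl B \<union> cl (A - B)"
proof -
  have "B \<union> (A - B) \<subseteq> X" using assms by blast
  then have "cl A \<subseteq> cl (B \<union> (A - B))" by (intro cl_mono) auto
  also have "\<dots> = cl B \<union> cl (A - B)" using assms by (intro cl_Un) auto
  finally show ?thesis .
qed

lemma cl_cl_subset:
  assumes A: "A \<subseteq> X"
  shows "cl (cl A) \<subseteq> cl A"
proof
  fix x assume x: "x \<in> cl (cl A)"
  show "x \<in> cl A"
  proof (rule ccontr)
    assume "x \<notin> cl A"
    then have "\<not> {x} \<hookrightarrow> A" and xX: "{x} \<subseteq> X" using x by (auto simp: mem_cl_iff)
    with separation[of "{x}" A] A obtain C D where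
      CD: "C \<subseteq> X" "D \<subseteq> X" "\<not> {x} \<hookrightarrow> (X - C)" "\<not> (X - D) \<hookrightarrow> A" "X - (C \<inter> D) \<notin> P"
      by blast
    \<comment> \<open>Every point near \<open>A\<close> lies in \<open>D\<close>, while \<open>x\<close> is near neither the negligible set
      \<open>C \<inter> D\<close> nor \<open>D - C\<close>, hence not near \<open>D\<close>.\<close>
    have "cl A \<subseteq> D"
      \<comment> \<open>A point of \<open>cl A\<close> outside \<open>D\<close> would give a
        singleton inside \<open>X - D\<close> that is near \<open>A\<close>, so that
        \<open>X - D\<close> itself would be near \<open>A\<close>.\<close>
      using prox_mono_left[of A "X - D" "{_}"] A CD(4) by (auto simp: mem_cl_iff) blast
    then have "x \<in> cl D" using x cl_mono[of "cl A" D] CD(2) by blast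
    moreover have "cl D \<subseteq> cl (C \<inter> D) \<union> cl (D - C \<inter> D)"
      using CD by (intro cl_subset_Un_Diff) auto
    moreover have "cl (C \<inter> D) = {}" using CD by (intro cl_eq_empty) auto
    moreover have "cl (D - C \<inter> D) \<subseteq> cl (X - C)" using CD by (intro cl_mono) auto
    ultimately have "x \<in> cl (X - C)" by blast
    then show False using CD(3) by (simp add: mem_cl_iff)
  qed
qed

text \<open>By the splitting of \<open>A\<close> along \<open>B\<close>, a point of
  \<open>cl A\<close> outside \<open>cl B\<close> would lie in \<open>cl (A - B)\<close>, hence in
  \<open>cl N\<close>, which is empty.\<close>

lemma cl_subset_of_Diff_negligible:
  assumes "A \<subseteq> X" "B \<subseteq> X" "N \<subseteq> X" "X - N \<notin> P" "A - B \<subseteq> N"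
  shows "cl A \<subseteq> cl B"
  using cl_subset_Un_Diff[of A B] cl_mono[of "A - B" N] cl_eq_empty[of N] assms by auto

end

theorem theorem4p6:
  fixes X :: "'a set" and prox :: "'a set \<Rightarrow> 'a set \<Rightarrow> bool" and P :: "'a set set"
    and A B :: "'a set"
  assumes "primal_proximity_space X prox P"
    and "A \<subseteq> X" and "B \<subseteq> X"
  shows "(A \<subseteq> B \<longrightarrow> point_primal_proximity X prox A \<subseteq> point_primal_proximity X prox B)
    \<and> point_primal_proximity X prox (A \<inter> B)
          \<subseteq> point_primal_proximity X prox A \<inter> point_primal_proximity X prox B
    \<and> point_primal_proximity X prox A \<union> point_primal_proximity X prox B
          = point_primal_proximity X prox (A \<union> B)
    \<and> point_primal_proximity X prox (point_primal_proximity X prox A)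
          \<subseteq> point_primal_proximity X prox A
    \<and> (X - A \<notin> P \<longrightarrow> point_primal_proximity X prox A = {})
    \<and> point_primal_proximity X prox {} = {}
    \<and> point_primal_proximity X prox A - point_primal_proximity X prox B
          \<subseteq> point_primal_proximity X prox (A - B)
    \<and> (X - B \<notin> P \<longrightarrow>
          point_primal_proximity X prox (A \<union> B) = point_primal_proximity X prox A
          \<and> point_primal_proximity X prox A = point_primal_proximity X prox (A - B))
    \<and> (X - ((A - B) \<union> (B - A)) \<notin> P \<longrightarrow>
          point_primal_proximity X prox A = point_primal_proximity X prox B)"
proof -
  interpret primal_proximity_space X prox P by fact
  note A = \<open>A \<subseteq> X\<close> and B = \<open>B \<subseteq> X\<close>
  have inter: "cl (A \<inter> B) \<subseteq> cl A \<inter> cl B"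
    using cl_mono[of "A \<inter> B" A] cl_mono[of "A \<inter> B" B] A B by auto
  have diff: "cl A - cl B \<subseteq> cl (A - B)"
    using cl_subset_Un_Diff[OF A B] by blast
  have negligible: "cl (A \<union> B) = cl A \<and> cl A = cl (A - B)" if "X - B \<notin> P"
  proof
    show "cl (A \<union> B) = cl A"
      using cl_Un[OF A B] cl_eq_empty[OF B that] by simp
    \<comment> \<open>For the inclusion from left to right the negligible set is \<open>B\<close>
      itself, because \<open>A - (A - B) = A \<inter> B\<close> lies in \<open>B\<close>.\<close>
    show "cl A = cl (A - B)"
      using cl_subset_of_Diff_negligible[of A "A - B" B] cl_mono[of "A - B" A] A B that
      by (simp add: subset_antisym Diff_subset subset_trans[OF Diff_subset] Diff_Diff_Int)
  qed
  have sym_diff: "cl A = cl B" if "X - ((A - B) \<union> (B - A)) \<notin> P"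
  proof -
    \<comment> \<open>The symmetric difference contains both \<open>A - B\<close> and
      \<open>B - A\<close>, so the same negligible set serves for both inclusions.\<close>
    have "(A - B) \<union> (B - A) \<subseteq> X" using A B by blast
    with that show ?thesis
      using cl_subset_of_Diff_negligible[of A B "(A - B) \<union> (B - A)"]
        cl_subset_of_Diff_negligible[of B A "(A - B) \<union> (B - A)"] A B
      by (simp add: subset_antisym)
  qed
  show ?thesis
    using cl_mono[OF _ B] inter cl_Un[OF A B] cl_cl_subset[OF A] cl_eq_empty[OF A] cl_empty
      diff negligible sym_diff
    by (intro conjI impI) simp_all
qed

end
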